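(* Let $\mathcal O\subseteq\mathbb R^d$ be a smooth, bounded domain and let $c_{\min}>0$. For a function $f:\mathcal O\to\mathbb R$ write $L_fu=\frac12\Delta u-fu$. Suppose that for $i\in\{1,2\}$ the functions $u_i\in H^2(\mathcal O)$, $f_i\in C(\mathcal O)$ and $h_i\in L^2(\mathcal O)$ satisfy $$L_{f_1}u_1=h_1\qquad\text{and}\qquad L_{f_2}u_2=h_2\quad\text{in }\mathcal O.$$ Assume moreover that $(u_1,f_1,h_1)$ satisfies $u_1\in C^2(\mathcal O)$ and $h_1\in L^\infty(\mathcal O)$, and that $$\inf_{x\in\mathcal O,\ i=1,2}u_i(x)\ge c_{\min}.$$ Then there exists a constant $C>0$, depending only on $c_{\min}$ and upper bounds on $\|u_1\|_{C^2(\mathcal O)}$ and $\|h_1\|_{L^\infty(\mathcal O)}$, such that $$\|f_1-f_2\|_{L^2(\mathcal O)}\le C\big(\|u_1-u_2\|_{H^2(\mathcal O)}+\|h_1-h_2\|_{L^2(\mathcal O)}\big).$$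
   Context: $H^2(\mathcal O)$ is the $L^2$-Sobolev space of order 2; $C(\mathcal O)$ is the space of continuous functions on $\mathcal O$ with the supremum norm; $C^2(\mathcal O)$ is the space of twice continuously differentiable functions with finite norm $\|u\|_{C^2(\mathcal O)}=\max_{|\beta|\le2}\sup_{x\in\mathcal O}|\partial^\beta u(x)|$. *)

theory Defs
  imports "HOL-Analysis.Analysis" "HOL-Probability.Essential_Supremum"
begin

definition pd :: "'n::finite \<Rightarrow> (real^'n \<Rightarrow> real) \<Rightarrow> real^'n \<Rightarrow> real" where
  "pd i f x = deriv (\<lambda>t. f (x + t *\<^sub>R axis i 1)) 0"

definition has_pd :: "'n::finite \<Rightarrow> (real^'n \<Rightarrow> real) \<Rightarrow> real^'n \<Rightarrow> bool" where
  "has_pd i f x \<longleftrightarrow> (\<lambda>t::real. f (x + t *\<^sub>R axis i 1)) differentiable (at 0)"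

text \<open>All partial derivatives of order at most \<open>k\<close> exist and are continuous on \<open>S\<close>
  (intended for open \<open>S\<close>).\<close>

primrec Ck_on :: "nat \<Rightarrow> (real^'n::finite) set \<Rightarrow> (real^'n \<Rightarrow> real) \<Rightarrow> bool" where
  "Ck_on 0 S f \<longleftrightarrow> continuous_on S f"
| "Ck_on (Suc k) S f \<longleftrightarrow>
     continuous_on S f \<and> (\<forall>i. (\<forall>x\<in>S. has_pd i f x) \<and> Ck_on k S (pd i f))"

definition smooth_fun_on :: "(real^'n::finite) set \<Rightarrow> (real^'n \<Rightarrow> real) \<Rightarrow> bool" where
  "smooth_fun_on S f \<longleftrightarrow> (\<forall>k. Ck_on k S f)"

definition mi_order :: "('n::finite \<Rightarrow> nat) \<Rightarrow> nat" where
  "mi_order \<beta> = (\<Sum>i\<in>UNIV. \<beta> i)"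

text \<open>The derivative of multi-index \<open>\<beta>\<close>. It is only applied to functions that are \<open>k\<close> times
  continuously differentiable with \<open>k \<ge> |\<beta>|\<close>; for these the order of differentiation,
  left unspecified here, is immaterial.\<close>

definition mderiv :: "('n::finite \<Rightarrow> nat) \<Rightarrow> (real^'n \<Rightarrow> real) \<Rightarrow> real^'n \<Rightarrow> real" where
  "mderiv \<beta> f = foldr pd (SOME is. \<forall>i. count_list is i = \<beta> i) f"

text \<open>A bounded domain with smooth boundary: a nonempty, bounded, connected open set which near
  every boundary point is, after relabelling and reflecting coordinates, the strict
  epigraph of a smooth function of the remaining \<open>d - 1\<close> coordinates. That \<open>\<gamma>\<close> is a function of
  the coordinates other than \<open>j\<close> is expressed by its not depending on the \<open>j\<close>-th one.\<close>

definition smooth_boundary :: "(real^'n::finite) set \<Rightarrow> bool" where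
  "smooth_boundary \<Omega> \<longleftrightarrow>
     (\<forall>p\<in>frontier \<Omega>. \<exists>r>0. \<exists>j. \<exists>s\<in>{1, -1::real}. \<exists>\<gamma>.
        smooth_fun_on UNIV \<gamma> \<and>
        (\<forall>x y. (\<forall>i. i \<noteq> j \<longrightarrow> x $ i = y $ i) \<longrightarrow> \<gamma> x = \<gamma> y) \<and>
        \<Omega> \<inter> ball p r = {x \<in> ball p r. s * (x $ j) > \<gamma> x})"

definition smooth_bounded_domain :: "(real^'n::finite) set \<Rightarrow> bool" where
  "smooth_bounded_domain \<Omega> \<longleftrightarrow>
     open \<Omega> \<and> connected \<Omega> \<and> \<Omega> \<noteq> {} \<and> bounded \<Omega> \<and> smooth_boundary \<Omega>"

definition C2_space :: "(real^'n::finite) set \<Rightarrow> (real^'n \<Rightarrow> real) set" where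
  "C2_space \<Omega> = {u. Ck_on 2 \<Omega> u \<and> (\<forall>\<beta>. mi_order \<beta> \<le> 2 \<longrightarrow> bounded (mderiv \<beta> u ` \<Omega>))}"

definition C2_norm :: "(real^'n::finite) set \<Rightarrow> (real^'n \<Rightarrow> real) \<Rightarrow> real" where
  "C2_norm \<Omega> u = (MAX \<beta>\<in>{\<beta>. mi_order \<beta> \<le> 2}. SUP x\<in>\<Omega>. \<bar>mderiv \<beta> u x\<bar>)"

text \<open>Elements of the Lebesgue and Sobolev spaces are represented by functions; everything below
  only depends on their values almost everywhere on \<open>\<Omega>\<close>.\<close>

definition L2_space :: "(real^'n::finite) set \<Rightarrow> (real^'n \<Rightarrow> real) set" where
  "L2_space \<Omega> = {f \<in> borel_measurable (lebesgue_on \<Omega>). integrable (lebesgue_on \<Omega>) (\<lambda>x. (f x)\<^sup>2)}"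

definition L2_norm :: "(real^'n::finite) set \<Rightarrow> (real^'n \<Rightarrow> real) \<Rightarrow> real" where
  "L2_norm \<Omega> f = sqrt (\<integral>x. (f x)\<^sup>2 \<partial>lebesgue_on \<Omega>)"

definition Linf_norm :: "(real^'n::finite) set \<Rightarrow> (real^'n \<Rightarrow> real) \<Rightarrow> ereal" where
  "Linf_norm \<Omega> f = esssup (lebesgue_on \<Omega>) (\<lambda>x. ereal \<bar>f x\<bar>)"

definition Linf_space :: "(real^'n::finite) set \<Rightarrow> (real^'n \<Rightarrow> real) set" where
  "Linf_space \<Omega> = {f \<in> borel_measurable (lebesgue_on \<Omega>). Linf_norm \<Omega> f < \<infinity>}"

definition locally_integrable :: "(real^'n::finite) set \<Rightarrow> (real^'n \<Rightarrow> real) \<Rightarrow> bool" where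
  "locally_integrable \<Omega> f \<longleftrightarrow> (\<forall>K. compact K \<and> K \<subseteq> \<Omega> \<longrightarrow> set_integrable lebesgue K f)"

definition test_functions :: "(real^'n::finite) set \<Rightarrow> (real^'n \<Rightarrow> real) set" where
  "test_functions \<Omega> = {\<phi>. smooth_fun_on UNIV \<phi> \<and>
     compact (closure {x. \<phi> x \<noteq> 0}) \<and> closure {x. \<phi> x \<noteq> 0} \<subseteq> \<Omega>}"

definition has_weak_deriv ::
  "(real^'n::finite) set \<Rightarrow> ('n \<Rightarrow> nat) \<Rightarrow> (real^'n \<Rightarrow> real) \<Rightarrow> (real^'n \<Rightarrow> real) \<Rightarrow> bool" where
  "has_weak_deriv \<Omega> \<beta> u v \<longleftrightarrow>
     locally_integrable \<Omega> u \<and> locally_integrable \<Omega> v \<and>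
     (\<forall>\<phi>\<in>test_functions \<Omega>.
        (\<integral>x. u x * mderiv \<beta> \<phi> x \<partial>lebesgue_on \<Omega>) =
        (-1) ^ mi_order \<beta> * (\<integral>x. v x * \<phi> x \<partial>lebesgue_on \<Omega>))"

text \<open>The weak derivative is unique up to null sets; an arbitrary version is chosen.\<close>

definition weak_deriv ::
  "(real^'n::finite) set \<Rightarrow> ('n \<Rightarrow> nat) \<Rightarrow> (real^'n \<Rightarrow> real) \<Rightarrow> real^'n \<Rightarrow> real" where
  "weak_deriv \<Omega> \<beta> u = (SOME v. has_weak_deriv \<Omega> \<beta> u v)"

definition H2_space :: "(real^'n::finite) set \<Rightarrow> (real^'n \<Rightarrow> real) set" where
  "H2_space \<Omega> = {u \<in> L2_space \<Omega>. \<forall>\<beta>. mi_order \<beta> \<le> 2 \<longrightarrow>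
     (\<exists>v. has_weak_deriv \<Omega> \<beta> u v) \<and> weak_deriv \<Omega> \<beta> u \<in> L2_space \<Omega>}"

definition H2_norm :: "(real^'n::finite) set \<Rightarrow> (real^'n \<Rightarrow> real) \<Rightarrow> real" where
  "H2_norm \<Omega> u = sqrt (\<Sum>\<beta>\<in>{\<beta>. mi_order \<beta> \<le> 2}. (L2_norm \<Omega> (weak_deriv \<Omega> \<beta> u))\<^sup>2)"

definition weak_laplacian :: "(real^'n::finite) set \<Rightarrow> (real^'n \<Rightarrow> real) \<Rightarrow> real^'n \<Rightarrow> real" where
  "weak_laplacian \<Omega> u x = (\<Sum>i\<in>UNIV. weak_deriv \<Omega> (\<lambda>k. if k = i then 2 else 0) u x)"

definition L_op ::
  "(real^'n::finite) set \<Rightarrow> (real^'n \<Rightarrow> real) \<Rightarrow> (real^'n \<Rightarrow> real) \<Rightarrow> real^'n \<Rightarrow> real" where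
  "L_op \<Omega> f u x = 1/2 * weak_laplacian \<Omega> u x - f x * u x"

end

theory Submission
  imports Defs
begin

text \<open>Write \<open>w = u1 - u2\<close> and \<open>h = h1 - h2\<close>. Subtracting the two equations gives, almost everywhere,
  \<open>(f1 - f2) u2 = (1/2) \<Delta> w - h - f1 w\<close>. The first equation also reads \<open>f1 u1 = (1/2) \<Delta> u1 - h1\<close>, so
  \<open>f1\<close> is bounded by a constant \<open>A\<close> that depends only on the dimension, the lower bound of \<open>u1\<close> and
  the bounds on \<open>u1\<close> in \<open>C\<^sup>2\<close> and on \<open>h1\<close> in \<open>L\<^sup>\<infinity>\<close>. Dividing by \<open>u2\<close>, which is bounded below, and
  integrating the squares yields the estimate (lemmas \<open>potential_difference_bound\<close> and
  \<open>potential_difference_L2_estimate\<close>).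

  This algebra needs two facts about the weak derivative, which is an arbitrary choice among
  almost everywhere equal functions: it respects differences almost everywhere
  (\<open>weak_deriv_diff_AE\<close>), and for \<open>u1\<close>, which is twice continuously differentiable, it agrees
  almost everywhere with the classical derivative (\<open>has_weak_deriv_double_pd\<close>). Both
  rest on the uniqueness of weak derivatives, that is, on the fundamental lemma of the calculus of
  variations (\<open>AE_eq_0_of_test_functions\<close>). The latter is proved with smooth functions that converge
  boundedly to the indicator function of a box: a locally integrable function that annihilates
  all test functions has integral zero over every closed box in the domain, hence vanishes
  almost everywhere by Lebesgue differentiation. Integration by parts for the second fact reduces to
  \<open>integral_pd_eq_0\<close>, a consequence of the translation invariance of Lebesgue measure.\<close>

section \<open>Partial derivatives and continuously differentiable functions\<close>

lemma has_pdI: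
  assumes "((\<lambda>t. f (x + t *\<^sub>R axis i 1)) has_real_derivative D) (at 0)"
  shows "has_pd i f x" "pd i f x = D"
  using assms
  by (auto simp: has_pd_def pd_def DERIV_imp_deriv real_differentiable_def)

lemma has_pd_imp_DERIV:
  assumes "has_pd i f x"
  shows "((\<lambda>t. f (x + t *\<^sub>R axis i 1)) has_real_derivative pd i f x) (at 0)"
  using assms by (auto simp: has_pd_def pd_def DERIV_deriv_iff_real_differentiable)

lemma has_pd_imp_DERIV_line:
  assumes "has_pd i f (x + t *\<^sub>R axis i 1)"
  shows "((\<lambda>t. f (x + t *\<^sub>R axis i 1)) has_real_derivative pd i f (x + t *\<^sub>R axis i 1)) (at t)"
proof -
  have "((\<lambda>s. f (x + (s + t) *\<^sub>R axis i 1)) has_real_derivative pd i f (x + t *\<^sub>R axis i 1)) (at 0)"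
    using has_pd_imp_DERIV[OF assms] by (simp add: algebra_simps)
  then show ?thesis
    using DERIV_shift[of "\<lambda>t. f (x + t *\<^sub>R axis i 1)" "pd i f (x + t *\<^sub>R axis i 1)" 0 t] by simp
qed

lemma has_pd_add:
  assumes "has_pd i f x" "has_pd i g x"
  shows "has_pd i (\<lambda>x. f x + g x) x" "pd i (\<lambda>x. f x + g x) x = pd i f x + pd i g x"
  using has_pdI[OF DERIV_add[OF has_pd_imp_DERIV[OF assms(1)] has_pd_imp_DERIV[OF assms(2)]]]
  by auto

lemma has_pd_mult:
  assumes "has_pd i f x" "has_pd i g x"
  shows "has_pd i (\<lambda>x. f x * g x) x"
    and "pd i (\<lambda>x. f x * g x) x = f x * pd i g x + pd i f x * g x"
  using has_pdI[OF DERIV_mult[OF has_pd_imp_DERIV[OF assms(1)] has_pd_imp_DERIV[OF assms(2)]]]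
  by (auto simp: algebra_simps)

lemma has_pd_const: "has_pd i (\<lambda>x. c) x" "pd i (\<lambda>x. c) x = 0"
  using has_pdI[OF DERIV_const] by auto

text \<open>Differentiability in a coordinate direction is a local property.\<close>

lemma pd_cong_open:
  assumes "open S" "x \<in> S" "\<And>y. y \<in> S \<Longrightarrow> f y = g y"
  shows "has_pd i f x \<longleftrightarrow> has_pd i g x" "pd i f x = pd i g x"
proof -
  have "((\<lambda>t. x + t *\<^sub>R axis i 1) \<longlongrightarrow> x + 0 *\<^sub>R axis i 1) (nhds (0::real))"
    by (intro tendsto_intros filterlim_ident)
  then have ev: "\<forall>\<^sub>F t in nhds 0. x + t *\<^sub>R axis i (1::real) \<in> S"
    using assms(1,2) by (auto simp: tendsto_def)
  then have ev: "\<forall>\<^sub>F t in nhds (0::real). f (x + t *\<^sub>R axis i 1) = g (x + t *\<^sub>R axis i 1)"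
    by eventually_elim (use assms(3) in auto)
  have D: "((\<lambda>t. f (x + t *\<^sub>R axis i 1)) has_real_derivative D) (at 0) \<longleftrightarrow>
           ((\<lambda>t. g (x + t *\<^sub>R axis i 1)) has_real_derivative D) (at 0)" for D
    by (rule DERIV_cong_ev[OF refl ev refl])
  show "has_pd i f x \<longleftrightarrow> has_pd i g x" "pd i f x = pd i g x"
    using D by (auto simp: has_pd_def pd_def real_differentiable_def deriv_def)
qed

lemma Ck_on_Suc_imp: "Ck_on (Suc k) S f \<Longrightarrow> Ck_on k S f"
  by (induction k arbitrary: f) auto

lemma Ck_on_imp_continuous_on: "Ck_on k S f \<Longrightarrow> continuous_on S f"
  by (cases k) auto

lemma Ck_on_const: "Ck_on k S (\<lambda>x. c)"
proof (induction k arbitrary: c)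
  case (Suc k)
  have "pd i (\<lambda>x. c) = (\<lambda>x. 0)" for i :: 'a
    by (auto simp: has_pd_const)
  with Suc show ?case by (auto simp: has_pd_const)
qed auto

lemma Ck_on_add:
  assumes "Ck_on k UNIV f" "Ck_on k UNIV g"
  shows "Ck_on k UNIV (\<lambda>x. f x + g x)"
  using assms
proof (induction k arbitrary: f g)
  case (Suc k)
  have "pd i (\<lambda>x. f x + g x) = (\<lambda>x. pd i f x + pd i g x)" for i
    using Suc.prems by (auto simp: has_pd_add)
  with Suc show ?case by (auto simp: has_pd_add intro!: continuous_intros)
qed (auto intro!: continuous_intros)

lemma Ck_on_mult:
  assumes "Ck_on k UNIV f" "Ck_on k UNIV g"
  shows "Ck_on k UNIV (\<lambda>x. f x * g x)"
  using assms
proof (induction k arbitrary: f g)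
  case (Suc k)
  have "pd i (\<lambda>x. f x * g x) = (\<lambda>x. f x * pd i g x + pd i f x * g x)" for i
    using Suc.prems by (auto simp: has_pd_mult)
  moreover have "Ck_on k UNIV f" "Ck_on k UNIV g"
    using Suc.prems Ck_on_Suc_imp by blast+
  ultimately show ?case using Suc
    by (auto simp: has_pd_mult intro!: continuous_intros Ck_on_add)
qed (auto intro!: continuous_intros)

lemma smooth_fun_on_mult:
  "smooth_fun_on UNIV f \<Longrightarrow> smooth_fun_on UNIV g \<Longrightarrow> smooth_fun_on UNIV (\<lambda>x. f x * g x)"
  by (auto simp: smooth_fun_on_def Ck_on_mult)

lemma smooth_fun_on_prod:
  assumes "finite I" "\<And>i. i \<in> I \<Longrightarrow> smooth_fun_on UNIV (f i)"
  shows "smooth_fun_on UNIV (\<lambda>x. \<Prod>i\<in>I. f i x)"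
  using assms
proof (induction I rule: finite_induct)
  case empty
  then show ?case by (simp add: smooth_fun_on_def Ck_on_const)
next
  case (insert i I)
  then show ?case by (simp add: smooth_fun_on_mult)
qed

lemma smooth_fun_on_pd: "smooth_fun_on S f \<Longrightarrow> smooth_fun_on S (pd i f)"
  unfolding smooth_fun_on_def by (meson Ck_on.simps(2))

lemma smooth_fun_on_has_pd: "smooth_fun_on UNIV f \<Longrightarrow> has_pd i f x"
  unfolding smooth_fun_on_def by (meson Ck_on.simps(2) UNIV_I)

lemma smooth_fun_on_imp_continuous_on: "smooth_fun_on S f \<Longrightarrow> continuous_on S f"
  unfolding smooth_fun_on_def by (meson Ck_on_imp_continuous_on)

text \<open>A smooth function of one real variable, here given with all its derivatives \<open>G n\<close>, stays
  smooth after composition with an affine function of one coordinate.\<close>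

lemma smooth_fun_on_affine_coordinate:
  fixes G :: "nat \<Rightarrow> real \<Rightarrow> real" and j :: "'n::finite"
  assumes G: "\<And>n t. (G n has_real_derivative G (Suc n) t) (at t)"
  shows "smooth_fun_on UNIV (\<lambda>x::real^'n. G n (a * x $ j + c))"
proof -
  have cont: "continuous_on UNIV (G n)" for n
    by (rule DERIV_continuous_on[OF has_field_derivative_at_within[OF G]])
  have contc: "continuous_on UNIV (\<lambda>x::real^'n. G n (a * x $ j + c))" for n
    by (rule continuous_on_compose2[OF cont[of n]]) (auto intro!: continuous_intros)
  have D: "((\<lambda>t. G n (a * (x + t *\<^sub>R axis i 1) $ j + c)) has_real_derivative
      (if i = j then a else 0) * G (Suc n) (a * x $ j + c)) (at 0)" for n i and x :: "real^'n"
  proof (cases "i = j")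
    case True
    have "((\<lambda>t. G n (a * (x $ j + t) + c)) has_real_derivative
        G (Suc n) (a * (x $ j + 0) + c) * a) (at 0)"
      by (rule DERIV_chain2[OF G]) (auto intro!: derivative_eq_intros)
    then show ?thesis using True by (simp add: algebra_simps)
  next
    case False
    then show ?thesis by (simp add: axis_def)
  qed
  have pd: "pd i (\<lambda>x. G n (a * x $ j + c)) =
      (\<lambda>x. (if i = j then a else 0) * G (Suc n) (a * x $ j + c))" for i n
    using has_pdI(2)[OF D] by auto
  have hpd: "has_pd i (\<lambda>x. G n (a * x $ j + c)) x" for i n and x :: "real^'n"
    using has_pdI(1)[OF D] by auto
  have "Ck_on k UNIV (\<lambda>x::real^'n. G n (a * x $ j + c))" for k n
  proof (induction k arbitrary: n)
    case (Suc k)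
    show ?case by (auto simp only: Ck_on.simps pd intro!: contc hpd Ck_on_mult Ck_on_const Suc)
  qed (use contc in auto)
  then show ?thesis by (auto simp: smooth_fun_on_def)
qed

section \<open>Smooth functions supported in a box\<close>

text \<open>The function \<open>P(1/t) exp(-1/t)\<close> for \<open>t > 0\<close>, extended by zero. For \<open>P = 1\<close> this is the standard
  smooth function that is flat at the origin; the polynomial factor makes the family closed
  under differentiation.\<close>

definition flat_fun :: "real poly \<Rightarrow> real \<Rightarrow> real" where
  "flat_fun P t = (if t > 0 then poly P (1 / t) * exp (- (1 / t)) else 0)"

text \<open>With \<open>s = 1/t\<close>, the derivative of \<open>P(s) exp(-s)\<close> with respect to \<open>t\<close> is \<open>Q(s) exp(-s)\<close>, where
  \<open>Q(s) = s\<^sup>2 (P(s) - P'(s))\<close>.\<close>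

definition flat_deriv_poly :: "real poly \<Rightarrow> real poly" where
  "flat_deriv_poly P = monom 1 2 * (P - pderiv P)"

lemma tendsto_poly_div_exp_0: "((\<lambda>y. poly P y * exp (- y)) \<longlongrightarrow> (0::real)) at_top"
proof -
  have "((\<lambda>y. \<Sum>i\<le>degree P. coeff P i * (y ^ i / exp y)) \<longlongrightarrow> (\<Sum>i\<le>degree P. coeff P i * 0)) at_top"
    by (intro tendsto_intros tendsto_power_div_exp_0)
  then show ?thesis
    by (simp add: poly_altdef sum_distrib_right exp_minus divide_inverse mult.assoc)
qed

lemma flat_fun_deriv: "(flat_fun P has_real_derivative flat_fun (flat_deriv_poly P) t) (at t)"
proof -
  consider "t > 0" | "t < 0" | "t = 0" by linarith
  then show ?thesis
  proof cases
    case 1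
    have "((\<lambda>t. poly P (1 / t) * exp (- (1 / t))) has_real_derivative
        flat_fun (flat_deriv_poly P) t) (at t)"
      using 1 by (auto intro!: derivative_eq_intros DERIV_chain2[OF poly_DERIV]
          simp: flat_fun_def flat_deriv_poly_def poly_monom field_simps power2_eq_square)
    then show ?thesis
      by (rule has_field_derivative_transform_within_open[where S = "{0<..}"])
         (use 1 in \<open>auto simp: flat_fun_def\<close>)
  next
    case 2
    have "((\<lambda>t. 0) has_real_derivative flat_fun (flat_deriv_poly P) t) (at t)"
      using 2 by (simp add: flat_fun_def)
    then show ?thesis
      by (rule has_field_derivative_transform_within_open[where S = "{..<0}"])
         (use 2 in \<open>auto simp: flat_fun_def\<close>)
  next
    case 3
    \<comment> \<open>The difference quotient at the origin is \<open>(1/h) P(1/h) exp(-1/h)\<close>, of the same form.\<close>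
    have "((\<lambda>y. poly ([:0, 1:] * P) y * exp (- y)) \<longlongrightarrow> (0::real)) at_top"
      by (rule tendsto_poly_div_exp_0)
    from filterlim_compose[OF this filterlim_inverse_at_top_right]
    have "((\<lambda>h. flat_fun P h / h) \<longlongrightarrow> 0) (at_right 0)"
    proof (rule Lim_transform_eventually)
      show "\<forall>\<^sub>F h in at_right 0. poly ([:0, 1:] * P) (inverse h) * exp (- inverse h) = flat_fun P h / h"
        by (auto simp: eventually_at_filter flat_fun_def field_simps)
    qed
    moreover have "((\<lambda>h. flat_fun P h / h) \<longlongrightarrow> 0) (at_left 0)"
      by (rule Lim_transform_eventually[OF tendsto_const])
         (auto simp: eventually_at_filter flat_fun_def)
    ultimately have "((\<lambda>h. flat_fun P h / h) \<longlongrightarrow> 0) (at 0)"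
      by (simp add: filterlim_split_at)
    then show ?thesis
      using 3 by (simp add: DERIV_def flat_fun_def)
  qed
qed

lemma smooth_flat_fun_affine_coordinate:
  "smooth_fun_on UNIV (\<lambda>x::real^'n::finite. flat_fun 1 (a * x $ j + c))"
  using smooth_fun_on_affine_coordinate[of "\<lambda>n. flat_fun ((flat_deriv_poly ^^ n) 1)" 0 a j c]
  by (simp add: flat_fun_deriv)

text \<open>A bump function that is positive exactly on the open box with corners \<open>a\<close> and \<open>b\<close>; for
  \<open>k \<longlonglongrightarrow> \<infinity>\<close> it increases to the indicator function of that box.\<close>

definition box_bump :: "real^'n::finite \<Rightarrow> real^'n \<Rightarrow> nat \<Rightarrow> real^'n \<Rightarrow> real" where
  "box_bump a b k x =
     (\<Prod>i\<in>UNIV. flat_fun 1 (real (Suc k) * (x $ i - a $ i)) *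
       flat_fun 1 (real (Suc k) * (b $ i - x $ i)))"

lemma smooth_box_bump: "smooth_fun_on UNIV (box_bump a b k)"
proof -
  have "smooth_fun_on UNIV (\<lambda>x::real^'a. \<Prod>i\<in>UNIV. flat_fun 1 (real (Suc k) * x $ i + (- (real (Suc k) * a $ i))) *
      flat_fun 1 ((- real (Suc k)) * x $ i + real (Suc k) * b $ i))"
    by (intro smooth_fun_on_prod smooth_fun_on_mult smooth_flat_fun_affine_coordinate) auto
  moreover have "box_bump a b k = (\<lambda>x::real^'a. \<Prod>i\<in>UNIV. flat_fun 1 (real (Suc k) * x $ i + (- (real (Suc k) * a $ i))) *
      flat_fun 1 ((- real (Suc k)) * x $ i + real (Suc k) * b $ i))"
    by (auto simp: box_bump_def fun_eq_iff algebra_simps)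
  ultimately show ?thesis by simp
qed

lemma flat_fun_one_bounds: "0 \<le> flat_fun 1 t" "flat_fun 1 t \<le> 1"
  by (auto simp: flat_fun_def)

lemma box_bump_bounds: "0 \<le> box_bump a b k x" "box_bump a b k x \<le> 1"
  unfolding box_bump_def
  by (auto intro!: prod_nonneg prod_le_1 mult_nonneg_nonneg mult_le_one flat_fun_one_bounds)

lemma box_bump_eq_0:
  assumes "x \<notin> box a b" shows "box_bump a b k x = 0"
proof -
  from assms obtain i where "\<not> (a $ i < x $ i \<and> x $ i < b $ i)"
    by (auto simp: mem_box_cart)
  then have "\<not> 0 < real (Suc k) * (x $ i - a $ i) \<or> \<not> 0 < real (Suc k) * (b $ i - x $ i)"
    by (auto simp: zero_less_mult_iff)
  then show ?thesis
    unfolding box_bump_def by (intro prod_zero) (auto simp: flat_fun_def)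
qed

lemma tendsto_flat_fun_one:
  assumes "t > 0" shows "(\<lambda>k. flat_fun 1 (real (Suc k) * t)) \<longlonglongrightarrow> 1"
proof -
  have "(\<lambda>k. exp (- (inverse (real (Suc k)) * inverse t))) \<longlonglongrightarrow> exp (- (0 * inverse t))"
    by (intro tendsto_intros LIMSEQ_inverse_real_of_nat)
  then show ?thesis
    using assms by (simp add: flat_fun_def divide_inverse del: of_nat_Suc)
qed

lemma box_bump_tendsto: "(\<lambda>k. box_bump a b k x) \<longlonglongrightarrow> indicator (box a b) x"
proof (cases "x \<in> box a b")
  case True
  then have "(\<lambda>k. box_bump a b k x) \<longlonglongrightarrow> (\<Prod>i\<in>(UNIV::'a set). 1 * 1)"
    unfolding box_bump_def
    by (intro tendsto_prod tendsto_mult tendsto_flat_fun_one) (auto simp: mem_box_cart)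
  then show ?thesis using True by simp
qed (simp add: box_bump_eq_0)

lemma box_bump_test_function:
  assumes "cbox a b \<subseteq> \<Omega>"
  shows "box_bump a b k \<in> test_functions \<Omega>"
proof -
  have "{x. box_bump a b k x \<noteq> 0} \<subseteq> cbox a b"
    using box_bump_eq_0 box_subset_cbox by blast
  then have sub: "closure {x. box_bump a b k x \<noteq> 0} \<subseteq> cbox a b"
    by (rule closure_minimal[OF _ closed_cbox])
  then have "compact (closure {x. box_bump a b k x \<noteq> 0})"
    by (meson bounded_cbox bounded_subset closed_closure compact_eq_bounded_closed)
  then show ?thesis
    using sub assms smooth_box_bump by (auto simp: test_functions_def)
qed

section \<open>Test functions and uniqueness of weak derivatives\<close>

lemma pd_eq_0_outside_closed:
  assumes "closed K" "\<And>x. x \<notin> K \<Longrightarrow> g x = 0" "x \<notin> K"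
  shows "has_pd i g x" "pd i g x = 0"
proof -
  have "has_pd i g x \<longleftrightarrow> has_pd i (\<lambda>x. 0) x" "pd i g x = pd i (\<lambda>x. 0) x"
    by (rule pd_cong_open[of "- K"]; use assms in \<open>simp add: open_Compl\<close>)+
  then show "has_pd i g x" "pd i g x = 0" by (simp_all add: has_pd_const)
qed

lemma eq_0_outside_support: "x \<notin> closure {x. g x \<noteq> 0} \<Longrightarrow> g x = 0"
  using closure_subset[of "{x. g x \<noteq> 0}"] by auto

lemma test_functions_pd:
  assumes "\<phi> \<in> test_functions \<Omega>"
  shows "pd i \<phi> \<in> test_functions \<Omega>"
proof -
  let ?K = "closure {x. \<phi> x \<noteq> 0}"
  have "pd i \<phi> x = 0" if "x \<notin> ?K" for x
    using pd_eq_0_outside_closed(2)[OF closed_closure eq_0_outside_support that] .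
  then have "{x. pd i \<phi> x \<noteq> 0} \<subseteq> ?K" by blast
  then have sub: "closure {x. pd i \<phi> x \<noteq> 0} \<subseteq> ?K"
    by (rule closure_minimal) simp
  moreover have "compact (closure {x. pd i \<phi> x \<noteq> 0})"
    by (rule compact_closure[THEN iffD2], rule bounded_subset[of ?K])
       (use \<open>{x. pd i \<phi> x \<noteq> 0} \<subseteq> ?K\<close> assms in \<open>simp_all add: test_functions_def compact_imp_bounded\<close>)
  ultimately show ?thesis
    using assms by (auto simp: test_functions_def smooth_fun_on_pd)
qed

lemma test_functions_mderiv:
  assumes "\<phi> \<in> test_functions \<Omega>" shows "mderiv \<beta> \<phi> \<in> test_functions \<Omega>"
proof -
  have "foldr pd is \<phi> \<in> test_functions \<Omega>" for "is"
    by (induction "is") (auto simp: assms test_functions_pd)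
  then show ?thesis by (simp add: mderiv_def)
qed

lemma compact_support_imp_integrable_bounded:
  fixes g :: "'a::euclidean_space \<Rightarrow> real"
  assumes g: "continuous_on UNIV g" and K: "compact K" and 0: "\<And>x. x \<notin> K \<Longrightarrow> g x = 0"
  shows "integrable lborel g" "\<exists>B\<ge>0. \<forall>x. \<bar>g x\<bar> \<le> B"
proof -
  have gK: "continuous_on K g" by (rule continuous_on_subset[OF g subset_UNIV])
  have "integrable lborel (\<lambda>x. indicator K x *\<^sub>R g x)"
    by (rule borel_integrable_compact[OF K gK])
  moreover have "(\<lambda>x. indicator K x *\<^sub>R g x) = g"
    using 0 by (auto simp: fun_eq_iff indicator_def)
  ultimately show "integrable lborel g" by simp
  have "bounded (g ` K)"
    by (intro compact_imp_bounded compact_continuous_image gK K)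
  then obtain B where B: "\<forall>y\<in>g ` K. norm y \<le> B"
    unfolding bounded_iff by (elim exE)
  have "\<bar>g x\<bar> \<le> max 0 B" for x
  proof (cases "x \<in> K")
    case True
    then have "norm (g x) \<le> B" using B by blast
    then show ?thesis by simp
  qed (simp add: 0)
  then show "\<exists>B\<ge>0. \<forall>x. \<bar>g x\<bar> \<le> B" by (intro exI[of _ "max 0 B"]) auto
qed

lemma test_function_bounded:
  assumes \<phi>: "\<phi> \<in> test_functions \<Omega>"
  shows "\<exists>B\<ge>0. \<forall>x. \<bar>\<phi> x\<bar> \<le> B"
proof (rule compact_support_imp_integrable_bounded(2))
  show "continuous_on UNIV \<phi>" "compact (closure {x. \<phi> x \<noteq> 0})"
    using \<phi> by (simp_all add: test_functions_def smooth_fun_on_imp_continuous_on)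
qed (rule eq_0_outside_support)

lemma integrable_mult_test_function:
  assumes \<Omega>: "open \<Omega>" and u: "locally_integrable \<Omega> u" and \<phi>: "\<phi> \<in> test_functions \<Omega>"
  shows "integrable (lebesgue_on \<Omega>) (\<lambda>x. u x * \<phi> x)"
proof -
  let ?K = "closure {x. \<phi> x \<noteq> 0}"
  have K: "compact ?K" "?K \<subseteq> \<Omega>" and sm: "smooth_fun_on UNIV \<phi>"
    using \<phi> by (auto simp: test_functions_def)
  have uK: "integrable lebesgue (\<lambda>x. indicator ?K x *\<^sub>R u x)"
    using u K by (auto simp: locally_integrable_def set_integrable_def)
  obtain B where B: "0 \<le> B" "\<And>x. \<bar>\<phi> x\<bar> \<le> B"
    using test_function_bounded[OF \<phi>] by blast
  have \<phi>m[measurable]: "\<phi> \<in> borel_measurable lebesgue"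
    using continuous_imp_measurable_on_sets_lebesgue[OF smooth_fun_on_imp_continuous_on[OF sm]]
    by (simp add: lebesgue_on_UNIV_eq)
  have "integrable lebesgue (\<lambda>x. (indicator ?K x *\<^sub>R u x) * \<phi> x)"
  proof (rule Bochner_Integration.integrable_bound[OF integrable_mult_right[OF uK, of B]])
    show "(\<lambda>x. indicator ?K x *\<^sub>R u x * \<phi> x) \<in> borel_measurable lebesgue"
      using borel_measurable_integrable[OF uK] \<phi>m by (rule borel_measurable_times)
    show "AE x in lebesgue. norm (indicator ?K x *\<^sub>R u x * \<phi> x) \<le> norm (B * indicator ?K x *\<^sub>R u x)"
      using B by (intro AE_I2) (auto simp: indicator_def abs_mult mult.commute intro!: mult_right_mono)
  qed
  moreover have "(\<lambda>x. (indicator ?K x *\<^sub>R u x) * \<phi> x) = (\<lambda>x. indicator \<Omega> x *\<^sub>R (u x * \<phi> x))"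
  proof
    fix x show "(indicator ?K x *\<^sub>R u x) * \<phi> x = indicator \<Omega> x *\<^sub>R (u x * \<phi> x)"
      using K(2) closure_subset[of "{x. \<phi> x \<noteq> 0}"] by (cases "\<phi> x = 0") (auto simp: indicator_def)
  qed
  ultimately show ?thesis
    using \<Omega> by (subst integrable_restrict_space) (auto simp: lborelD)
qed

text \<open>Testing with the bump functions of a box and letting them tend to its indicator function.\<close>

lemma integral_cbox_eq_0_of_test_functions:
  assumes \<Omega>: "open \<Omega>" and v: "locally_integrable \<Omega> v"
    and 0: "\<And>\<phi>. \<phi> \<in> test_functions \<Omega> \<Longrightarrow> (\<integral>x. v x * \<phi> x \<partial>lebesgue_on \<Omega>) = 0"
    and ab: "cbox a b \<subseteq> \<Omega>"
  shows "integral (cbox a b) v = 0"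
proof -
  define w where "w x = indicator (cbox a b) x *\<^sub>R v x" for x
  have vC: "set_integrable lebesgue (cbox a b) v"
    using v ab by (auto simp: locally_integrable_def)
  then have w: "integrable lebesgue w"
    by (simp add: set_integrable_def w_def[abs_def])
  have bm[measurable]: "box_bump a b k \<in> borel_measurable lebesgue" for k
    using continuous_imp_measurable_on_sets_lebesgue[OF smooth_fun_on_imp_continuous_on[OF smooth_box_bump]]
    by (simp add: lebesgue_on_UNIV_eq)
  have "(\<lambda>k. \<integral>x. w x * box_bump a b k x \<partial>lebesgue) \<longlonglongrightarrow> (\<integral>x. w x * indicator (box a b) x \<partial>lebesgue)"
  proof (rule integral_dominated_convergence[where w = "\<lambda>x. \<bar>w x\<bar>"])
    show "(\<lambda>x. w x * indicator (box a b) x) \<in> borel_measurable lebesgue"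
      using borel_measurable_integrable[OF w] by (intro borel_measurable_times borel_measurable_indicator) auto
    show "(\<lambda>x. w x * box_bump a b k x) \<in> borel_measurable lebesgue" for k
      using borel_measurable_integrable[OF w] bm by (intro borel_measurable_times)
    show "AE x in lebesgue. (\<lambda>k. w x * box_bump a b k x) \<longlonglongrightarrow> w x * indicator (box a b) x"
      by (intro AE_I2 tendsto_intros box_bump_tendsto)
    show "AE x in lebesgue. norm (w x * box_bump a b k x) \<le> \<bar>w x\<bar>" for k
      using box_bump_bounds[of a b k] by (intro AE_I2) (auto simp: abs_mult intro!: mult_left_le)
  qed (use w in auto)
  moreover have "(\<integral>x. w x * box_bump a b k x \<partial>lebesgue) = 0" for k
  proof -
    have eq: "(\<lambda>x. w x * box_bump a b k x) = (\<lambda>x. indicator \<Omega> x *\<^sub>R (v x * box_bump a b k x))"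
    proof
      fix x show "w x * box_bump a b k x = indicator \<Omega> x *\<^sub>R (v x * box_bump a b k x)"
        using ab box_subset_cbox[of a b] box_bump_eq_0[of x a b k]
        by (cases "x \<in> box a b") (auto simp: w_def indicator_def)
    qed
    have "(\<integral>x. v x * box_bump a b k x \<partial>lebesgue_on \<Omega>) = 0"
      by (rule 0[OF box_bump_test_function[OF ab]])
    then show ?thesis
      using \<Omega> unfolding eq by (subst (asm) integral_restrict_space) (auto simp: lborelD)
  qed
  ultimately have "(\<integral>x. w x * indicator (box a b) x \<partial>lebesgue) = 0"
    by (simp add: LIMSEQ_const_iff)
  also have "(\<lambda>x. w x * indicator (box a b) x) = (\<lambda>x. indicator (box a b) x *\<^sub>R v x)"
    using box_subset_cbox[of a b] by (auto simp: fun_eq_iff w_def indicator_def)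
  finally have "(LINT x:box a b|lebesgue. v x) = 0"
    by (simp add: set_lebesgue_integral_def)
  moreover have "set_integrable lebesgue (box a b) v"
    by (rule set_integrable_subset[OF vC]) (auto simp: box_subset_cbox)
  ultimately have "integral (box a b) v = 0"
    using set_lebesgue_integral_eq_integral(2) by fastforce
  then show ?thesis by (simp add: integral_open_interval)
qed

text \<open>The Lebesgue differentiation theorem on shrinking cubes turns vanishing integrals into
  vanishing values.\<close>

lemma AE_eq_0_of_integral_cbox_eq_0:
  fixes v :: "'a::euclidean_space \<Rightarrow> real"
  assumes v: "set_integrable lebesgue (cbox c d) v"
    and 0: "\<And>a b. cbox a b \<subseteq> cbox c d \<Longrightarrow> integral (cbox a b) v = 0"
  shows "AE x in lebesgue. x \<in> cbox c d \<longrightarrow> v x = 0"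
proof -
  define f where "f x = indicator (cbox c d) x *\<^sub>R v x" for x
  have "set_integrable lebesgue UNIV f"
    using v by (simp add: set_integrable_def f_def[abs_def])
  then have "set_integrable lebesgue (cbox a b) f" for a b
    by (rule set_integrable_subset) auto
  then have "f integrable_on cbox a b" for a b
    by (rule set_lebesgue_integral_eq_integral(1))
  then obtain N where N: "negligible N"
    and lim: "\<And>x e. \<lbrakk>x \<notin> N; 0 < e\<rbrakk> \<Longrightarrow> \<exists>\<delta>>0. \<forall>h. 0 < h \<and> h < \<delta> \<longrightarrow>
        norm (integral (cbox x (x + h *\<^sub>R One)) f /\<^sub>R h ^ DIM('a) - f x) < e"
    using integrable_ccontinuous_explicit[of f] by blast
  have zero: "v x = 0" if x: "x \<in> box c d" "x \<notin> N" for x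
  proof (rule ccontr)
    assume "v x \<noteq> 0"
    then obtain \<delta> where \<delta>: "\<delta> > 0" and lt: "\<And>h. 0 < h \<and> h < \<delta> \<Longrightarrow>
        norm (integral (cbox x (x + h *\<^sub>R One)) f /\<^sub>R h ^ DIM('a) - f x) < \<bar>v x\<bar>"
      using lim[OF x(2), of "\<bar>v x\<bar>"] by auto
    obtain r where r: "r > 0" "ball x r \<subseteq> box c d"
      using open_box x(1) open_contains_ball by blast
    \<comment> \<open>A cube of side \<open>h\<close> has diameter at most \<open>h\<close> times the dimension in the Euclidean norm.\<close>
    define h where "h = min (\<delta> / 2) (r / (2 * real DIM('a)))"
    have h: "0 < h" "h < \<delta>" using \<delta> r by (auto simp: h_def)
    have hr: "h * real DIM('a) < r"
    proof -
      have "h * real DIM('a) \<le> r / (2 * real DIM('a)) * real DIM('a)"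
        by (intro mult_right_mono) (auto simp: h_def)
      also have "\<dots> < r" using r by simp
      finally show ?thesis .
    qed
    have "cbox x (x + h *\<^sub>R One) \<subseteq> ball x r"
    proof
      fix y assume y: "y \<in> cbox x (x + h *\<^sub>R One)"
      have "norm (y - x) \<le> (\<Sum>i\<in>Basis. \<bar>(y - x) \<bullet> i\<bar>)"
        by (rule norm_le_l1)
      also have "\<dots> \<le> (\<Sum>i\<in>(Basis::'a set). h)"
        using y by (intro sum_mono) (auto simp: mem_box inner_simps)
      finally show "y \<in> ball x r"
        using hr by (simp add: dist_norm norm_minus_commute mult.commute)
    qed
    then have sub: "cbox x (x + h *\<^sub>R One) \<subseteq> cbox c d"
      using r(2) box_subset_cbox[of c d] by blast
    have "integral (cbox x (x + h *\<^sub>R One)) f = integral (cbox x (x + h *\<^sub>R One)) v"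
      by (rule integral_cong) (use sub in \<open>auto simp: f_def indicator_def\<close>)
    then have "integral (cbox x (x + h *\<^sub>R One)) f = 0"
      using 0[OF sub] by simp
    moreover have "f x = v x" using x box_subset_cbox[of c d] by (auto simp: f_def)
    ultimately show False
      using lt[of h] h by simp
  qed
  have "negligible (N \<union> (cbox c d - box c d))"
    using N negligible_frontier_interval by (rule negligible_Un)
  then have "N \<union> (cbox c d - box c d) \<in> null_sets lebesgue"
    by (simp add: negligible_iff_null_sets)
  moreover have "{x \<in> space lebesgue. \<not> (x \<in> cbox c d \<longrightarrow> v x = 0)} \<subseteq> N \<union> (cbox c d - box c d)"
    using zero by auto
  ultimately show ?thesis by (rule AE_I')
qed

text \<open>The fundamental lemma of the calculus of variations.\<close>

lemma AE_eq_0_of_test_functions: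
  assumes \<Omega>: "open \<Omega>" and v: "locally_integrable \<Omega> v"
    and 0: "\<And>\<phi>. \<phi> \<in> test_functions \<Omega> \<Longrightarrow> (\<integral>x. v x * \<phi> x \<partial>lebesgue_on \<Omega>) = 0"
  shows "AE x in lebesgue_on \<Omega>. v x = 0"
proof -
  obtain \<D> where \<D>: "countable \<D>" "\<D> \<subseteq> Pow \<Omega>"
      "\<And>X. X \<in> \<D> \<Longrightarrow> \<exists>a b. X = cbox a b" "\<Union>\<D> = \<Omega>"
    by (rule open_countable_Union_open_cbox[OF \<Omega>]) (rule that; assumption)
  have "AE x in lebesgue. x \<in> X \<longrightarrow> v x = 0" if X: "X \<in> \<D>" for X
  proof -
    obtain c d where cd: "X = cbox c d" "cbox c d \<subseteq> \<Omega>" using \<D>(2) \<D>(3)[OF X] X by blast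
    have "set_integrable lebesgue (cbox c d) v"
      using v cd by (auto simp: locally_integrable_def)
    then show ?thesis unfolding cd(1)
      by (rule AE_eq_0_of_integral_cbox_eq_0)
         (use cd(2) in \<open>auto intro!: integral_cbox_eq_0_of_test_functions[OF \<Omega> v 0]\<close>)
  qed
  then have "AE x in lebesgue. \<forall>X\<in>\<D>. x \<in> X \<longrightarrow> v x = 0"
    by (subst AE_ball_countable[OF \<D>(1)]) blast
  then have "AE x in lebesgue. x \<in> \<Omega> \<longrightarrow> v x = 0"
    by eventually_elim (use \<D>(4) in blast)
  then show ?thesis
    using \<Omega> by (subst AE_restrict_space_iff) (auto simp: lborelD)
qed

lemma locally_integrable_diff:
  "locally_integrable \<Omega> u \<Longrightarrow> locally_integrable \<Omega> v \<Longrightarrow> locally_integrable \<Omega> (\<lambda>x. u x - v x)"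
  by (auto simp: locally_integrable_def)

lemma has_weak_derivD:
  assumes "has_weak_deriv \<Omega> \<beta> u v"
  shows "locally_integrable \<Omega> u" "locally_integrable \<Omega> v"
    and "\<phi> \<in> test_functions \<Omega> \<Longrightarrow> (\<integral>x. u x * mderiv \<beta> \<phi> x \<partial>lebesgue_on \<Omega>) =
        (-1) ^ mi_order \<beta> * (\<integral>x. v x * \<phi> x \<partial>lebesgue_on \<Omega>)"
  using assms unfolding has_weak_deriv_def by blast+

lemma has_weak_deriv_unique:
  assumes \<Omega>: "open \<Omega>" and v: "has_weak_deriv \<Omega> \<beta> u v" and w: "has_weak_deriv \<Omega> \<beta> u w"
  shows "AE x in lebesgue_on \<Omega>. v x = w x"
proof -
  have "AE x in lebesgue_on \<Omega>. v x - w x = 0"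
  proof (rule AE_eq_0_of_test_functions[OF \<Omega>])
    show "locally_integrable \<Omega> (\<lambda>x. v x - w x)"
      by (rule locally_integrable_diff[OF has_weak_derivD(2)[OF v] has_weak_derivD(2)[OF w]])
    fix \<phi> assume \<phi>: "\<phi> \<in> test_functions \<Omega>"
    have "(-1) ^ mi_order \<beta> * (\<integral>x. v x * \<phi> x \<partial>lebesgue_on \<Omega>) =
          (-1) ^ mi_order \<beta> * (\<integral>x. w x * \<phi> x \<partial>lebesgue_on \<Omega>)"
      using has_weak_derivD(3)[OF v \<phi>] has_weak_derivD(3)[OF w \<phi>] by simp
    then have eq: "(\<integral>x. v x * \<phi> x \<partial>lebesgue_on \<Omega>) = (\<integral>x. w x * \<phi> x \<partial>lebesgue_on \<Omega>)"
      by simp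
    have "integrable (lebesgue_on \<Omega>) (\<lambda>x. v x * \<phi> x)" "integrable (lebesgue_on \<Omega>) (\<lambda>x. w x * \<phi> x)"
      by (rule integrable_mult_test_function[OF \<Omega> has_weak_derivD(2)[OF v] \<phi>],
          rule integrable_mult_test_function[OF \<Omega> has_weak_derivD(2)[OF w] \<phi>])
    from Bochner_Integration.integral_diff[OF this] eq
    show "(\<integral>x. (v x - w x) * \<phi> x \<partial>lebesgue_on \<Omega>) = 0"
      by (simp only: left_diff_distrib diff_self)
  qed
  then show ?thesis by eventually_elim simp
qed

lemma has_weak_deriv_diff:
  assumes \<Omega>: "open \<Omega>" and 1: "has_weak_deriv \<Omega> \<beta> u1 v1" and 2: "has_weak_deriv \<Omega> \<beta> u2 v2"
  shows "has_weak_deriv \<Omega> \<beta> (\<lambda>x. u1 x - u2 x) (\<lambda>x. v1 x - v2 x)"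
  unfolding has_weak_deriv_def
proof (intro conjI ballI)
  show "locally_integrable \<Omega> (\<lambda>x. u1 x - u2 x)" "locally_integrable \<Omega> (\<lambda>x. v1 x - v2 x)"
    by (rule locally_integrable_diff[OF has_weak_derivD(1)[OF 1] has_weak_derivD(1)[OF 2]],
        rule locally_integrable_diff[OF has_weak_derivD(2)[OF 1] has_weak_derivD(2)[OF 2]])
  fix \<phi> assume \<phi>: "\<phi> \<in> test_functions \<Omega>"
  have "integrable (lebesgue_on \<Omega>) (\<lambda>x. v1 x * \<phi> x)" "integrable (lebesgue_on \<Omega>) (\<lambda>x. v2 x * \<phi> x)"
       "integrable (lebesgue_on \<Omega>) (\<lambda>x. u1 x * mderiv \<beta> \<phi> x)"
       "integrable (lebesgue_on \<Omega>) (\<lambda>x. u2 x * mderiv \<beta> \<phi> x)"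
    by (rule integrable_mult_test_function[OF \<Omega> has_weak_derivD(2)[OF 1] \<phi>],
        rule integrable_mult_test_function[OF \<Omega> has_weak_derivD(2)[OF 2] \<phi>],
        rule integrable_mult_test_function[OF \<Omega> has_weak_derivD(1)[OF 1] test_functions_mderiv[OF \<phi>]],
        rule integrable_mult_test_function[OF \<Omega> has_weak_derivD(1)[OF 2] test_functions_mderiv[OF \<phi>]])
  then show "(\<integral>x. (u1 x - u2 x) * mderiv \<beta> \<phi> x \<partial>lebesgue_on \<Omega>) =
      (- 1) ^ mi_order \<beta> * (\<integral>x. (v1 x - v2 x) * \<phi> x \<partial>lebesgue_on \<Omega>)"
    using has_weak_derivD(3)[OF 1 \<phi>] has_weak_derivD(3)[OF 2 \<phi>]
    by (simp add: left_diff_distrib right_diff_distrib)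
qed

lemma has_weak_deriv_weak_deriv:
  "has_weak_deriv \<Omega> \<beta> u v \<Longrightarrow> has_weak_deriv \<Omega> \<beta> u (weak_deriv \<Omega> \<beta> u)"
  unfolding weak_deriv_def by (rule someI[of "has_weak_deriv \<Omega> \<beta> u"])

lemma weak_deriv_eq_AE:
  "open \<Omega> \<Longrightarrow> has_weak_deriv \<Omega> \<beta> u v \<Longrightarrow> AE x in lebesgue_on \<Omega>. weak_deriv \<Omega> \<beta> u x = v x"
  by (rule has_weak_deriv_unique[OF _ has_weak_deriv_weak_deriv])

lemma weak_deriv_diff_AE:
  assumes "open \<Omega>" "has_weak_deriv \<Omega> \<beta> u1 v1" "has_weak_deriv \<Omega> \<beta> u2 v2"
  shows "AE x in lebesgue_on \<Omega>.
    weak_deriv \<Omega> \<beta> (\<lambda>x. u1 x - u2 x) x = weak_deriv \<Omega> \<beta> u1 x - weak_deriv \<Omega> \<beta> u2 x"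
  by (rule weak_deriv_eq_AE[OF assms(1) has_weak_deriv_diff[OF assms(1)
      has_weak_deriv_weak_deriv[OF assms(2)] has_weak_deriv_weak_deriv[OF assms(3)]]])

lemma mderiv_zero: "mderiv (\<lambda>_. 0) f = f"
proof -
  have "(SOME is. \<forall>i::'a. count_list is i = 0) = []"
    by (rule some_equality) (auto simp: count_list_0_iff)
  then show ?thesis by (simp add: mderiv_def)
qed

lemma weak_deriv_zero_AE:
  assumes "open \<Omega>" "locally_integrable \<Omega> u"
  shows "AE x in lebesgue_on \<Omega>. weak_deriv \<Omega> (\<lambda>_. 0) u x = u x"
  using assms by (intro weak_deriv_eq_AE) (auto simp: has_weak_deriv_def mderiv_zero mi_order_def)

section \<open>Classical derivatives are weak derivatives\<close>

lemma lborel_integral_translation: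
  fixes g :: "'a::euclidean_space \<Rightarrow> real"
  assumes [measurable]: "g \<in> borel_measurable borel"
  shows "(\<integral>x. g (x + c) \<partial>lborel) = (\<integral>x. g x \<partial>lborel)"
    and "integrable lborel g \<Longrightarrow> integrable lborel (\<lambda>x. g (x + c))"
proof -
  have "(\<integral>x. g x \<partial>lborel) = (\<integral>x. g x \<partial>distr lborel borel ((+) c))"
    by (simp add: lborel_distr_plus)
  also have "\<dots> = (\<integral>x. g (c + x) \<partial>lborel)"
    by (rule integral_distr) auto
  finally show "(\<integral>x. g (x + c) \<partial>lborel) = (\<integral>x. g x \<partial>lborel)"
    by (simp add: add.commute)
  assume "integrable lborel g"
  then have "integrable (distr lborel borel ((+) c)) g"
    by (simp add: lborel_distr_plus)
  then have "integrable lborel (\<lambda>x. g (c + x))"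
    by (subst (asm) integrable_distr_eq) auto
  then show "integrable lborel (\<lambda>x. g (x + c))"
    by (simp add: add.commute)
qed

text \<open>The integral of a partial derivative of a compactly supported function vanishes: the difference
  quotients have integral zero by translation invariance, and they converge to the derivative
  boundedly and with uniformly bounded supports.\<close>

lemma integral_pd_eq_0:
  fixes g :: "real^'n::finite \<Rightarrow> real"
  assumes g: "continuous_on UNIV g" and pg: "continuous_on UNIV (pd i g)" and d: "\<And>x. has_pd i g x"
    and K: "compact K" and 0: "\<And>x. x \<notin> K \<Longrightarrow> g x = 0"
  shows "(\<integral>x. pd i g x \<partial>lborel) = 0"
proof -
  have pd0: "pd i g x = 0" if "x \<notin> K" for x
    using pd_eq_0_outside_closed(2)[OF compact_imp_closed[OF K] 0 that] .
  have "\<exists>B\<ge>0. \<forall>x. \<bar>pd i g x\<bar> \<le> B"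
    by (rule compact_support_imp_integrable_bounded(2)[OF pg K]) (rule pd0)
  then obtain B where B: "B \<ge> 0" "\<forall>x. \<bar>pd i g x\<bar> \<le> B" by auto
  obtain R where R: "\<forall>x\<in>K. norm x \<le> R"
    using compact_imp_bounded[OF K] unfolding bounded_iff by (elim exE)
  have gm[measurable]: "g \<in> borel_measurable borel" and pm[measurable]: "pd i g \<in> borel_measurable borel"
    using g pg by (auto intro: borel_measurable_continuous_onI)
  have gi: "integrable lborel g"
    by (rule compact_support_imp_integrable_bounded(1)[OF g K 0])
  let ?e = "axis i (1::real)"
  define h :: "nat \<Rightarrow> real" where "h n = inverse (real (Suc n))" for n
  have h: "0 < h n" "h n \<le> 1" for n by (auto simp: h_def field_simps)
  define q where "q n x = (g (x + h n *\<^sub>R ?e) - g x) / h n" for n x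
  have "(\<lambda>n. \<integral>x. q n x \<partial>lborel) \<longlonglongrightarrow> (\<integral>x. pd i g x \<partial>lborel)"
  proof (rule integral_dominated_convergence[where w = "\<lambda>x. B * indicator (cball 0 (R + 1)) x"])
    show "integrable lborel (\<lambda>x::real^'n. B * indicator (cball 0 (R + 1)) x)"
      by (intro integrable_mult_right integrable_real_indicator emeasure_bounded_finite) auto
    show "q n \<in> borel_measurable lborel" for n
      unfolding q_def by measurable
    show "AE x in lborel. (\<lambda>n. q n x) \<longlonglongrightarrow> pd i g x"
    proof (rule AE_I2)
      fix x
      have "((\<lambda>t. (g (x + t *\<^sub>R ?e) - g x) / t) \<longlongrightarrow> pd i g x) (at 0)"
        using has_pd_imp_DERIV[OF d, of x] by (simp add: DERIV_def)
      moreover have "filterlim h (at 0) sequentially"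
        unfolding filterlim_at h_def using LIMSEQ_inverse_real_of_nat by auto
      ultimately show "(\<lambda>n. q n x) \<longlonglongrightarrow> pd i g x"
        unfolding q_def by (rule filterlim_compose)
    qed
    show "AE x in lborel. norm (q n x) \<le> B * indicator (cball 0 (R + 1)) x" for n
    proof (rule AE_I2)
      fix x
      show "norm (q n x) \<le> B * indicator (cball 0 (R + 1)) x"
      proof (cases "x \<in> cball 0 (R + 1)")
        case True
        have "\<exists>t>0. t < h n \<and> g (x + h n *\<^sub>R ?e) - g (x + 0 *\<^sub>R ?e) = (h n - 0) * pd i g (x + t *\<^sub>R ?e)"
          by (rule MVT2[OF h(1)]) (rule has_pd_imp_DERIV_line[OF d])
        then obtain t where "g (x + h n *\<^sub>R ?e) - g x = h n * pd i g (x + t *\<^sub>R ?e)" by auto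
        then have "q n x = pd i g (x + t *\<^sub>R ?e)"
          using h(1)[of n] by (simp add: q_def)
        then show ?thesis using B True by simp
      next
        case False
        then have x: "norm x > R + 1" by simp
        have "norm x \<le> norm (x + h n *\<^sub>R ?e) + norm (h n *\<^sub>R ?e)"
          by (metis add_diff_cancel_right' norm_triangle_ineq4)
        then have "norm (x + h n *\<^sub>R ?e) > R" using x h[of n] by (simp add: norm_axis_1)
        then have "g (x + h n *\<^sub>R ?e) = 0" "g x = 0"
          using x R by (auto intro!: 0)
        then show ?thesis using False by (simp add: q_def)
      qed
    qed
  qed simp
  moreover have "(\<integral>x. q n x \<partial>lborel) = 0" for n
    unfolding q_def
    using lborel_integral_translation(1)[OF gm] lborel_integral_translation(2)[OF gm gi] gi
    by (simp add: Bochner_Integration.integral_diff)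
  ultimately show ?thesis by (simp add: LIMSEQ_const_iff)
qed

lemma locally_integrable_continuous:
  assumes "continuous_on \<Omega> u" shows "locally_integrable \<Omega> u"
  unfolding locally_integrable_def set_integrable_def
proof (intro allI impI)
  fix K assume K: "compact K \<and> K \<subseteq> \<Omega>"
  have "integrable lborel (\<lambda>x. indicator K x *\<^sub>R u x)"
    by (rule borel_integrable_compact) (use K assms continuous_on_subset in auto)
  then show "integrable lebesgue (\<lambda>x. indicator K x *\<^sub>R u x)"
    by (subst integrable_completion) (auto dest: borel_measurable_integrable)
qed

text \<open>Integration by parts against a test function, applied to the product extended by zero
  outside \<open>\<Omega>\<close>.\<close>

lemma integral_mult_pd_test_function:
  fixes u :: "real^'n::finite \<Rightarrow> real"
  assumes \<Omega>: "open \<Omega>" and u: "continuous_on \<Omega> u" and pu: "continuous_on \<Omega> (pd i u)"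
    and d: "\<And>x. x \<in> \<Omega> \<Longrightarrow> has_pd i u x" and \<phi>: "\<phi> \<in> test_functions \<Omega>"
  shows "(\<integral>x. u x * pd i \<phi> x \<partial>lebesgue_on \<Omega>) = - (\<integral>x. pd i u x * \<phi> x \<partial>lebesgue_on \<Omega>)"
proof -
  let ?K = "closure {x. \<phi> x \<noteq> 0}"
  have K: "compact ?K" "?K \<subseteq> \<Omega>" and sm: "smooth_fun_on UNIV \<phi>"
    using \<phi> by (auto simp: test_functions_def)
  have \<phi>0: "\<phi> x = 0" if "x \<notin> ?K" for x
    using eq_0_outside_support[OF that] .
  have oK: "open (- ?K)" by (simp add: open_Compl)
  define g where "g x = (if x \<in> \<Omega> then u x * \<phi> x else 0)" for x
  define G where "G x = (if x \<in> \<Omega> then u x * pd i \<phi> x + pd i u x * \<phi> x else 0)" for x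
  have g0: "g x = 0" if "x \<notin> ?K" for x using \<phi>0[OF that] by (simp add: g_def)
  have p0: "pd i \<phi> x = 0" if "x \<notin> ?K" for x
    using pd_eq_0_outside_closed(2)[OF closed_closure \<phi>0 that] .
  have G0: "G x = 0" if "x \<notin> ?K" for x using \<phi>0[OF that] p0[OF that] by (simp add: G_def)
  have c\<phi>: "continuous_on S \<phi>" "continuous_on S (pd i \<phi>)" for S
    by (rule continuous_on_subset[OF smooth_fun_on_imp_continuous_on subset_UNIV],
        rule sm smooth_fun_on_pd[OF sm])+
  have cover: "\<Omega> \<union> - ?K = UNIV" using K(2) by auto
  have "continuous_on (\<Omega> \<union> - ?K) g"
  proof (rule continuous_on_open_Un[OF \<Omega> oK])
    have "continuous_on \<Omega> (\<lambda>x. u x * \<phi> x)" by (intro continuous_intros u c\<phi>)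
    then show "continuous_on \<Omega> g" by (rule continuous_on_eq) (simp add: g_def)
    show "continuous_on (- ?K) g"
      by (rule continuous_on_eq[OF continuous_on_const[of _ 0]]) (simp add: g0)
  qed
  then have cg: "continuous_on UNIV g" by (simp only: cover)
  have "continuous_on (\<Omega> \<union> - ?K) G"
  proof (rule continuous_on_open_Un[OF \<Omega> oK])
    have "continuous_on \<Omega> (\<lambda>x. u x * pd i \<phi> x + pd i u x * \<phi> x)" by (intro continuous_intros u pu c\<phi>)
    then show "continuous_on \<Omega> G" by (rule continuous_on_eq) (simp add: G_def)
    show "continuous_on (- ?K) G"
      by (rule continuous_on_eq[OF continuous_on_const[of _ 0]]) (simp add: G0)
  qed
  then have cG: "continuous_on UNIV G" by (simp only: cover)
  have gG: "has_pd i g x \<and> pd i g x = G x" for x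
  proof (cases "x \<in> \<Omega>")
    case True
    have "has_pd i g x = has_pd i (\<lambda>x. u x * \<phi> x) x" "pd i g x = pd i (\<lambda>x. u x * \<phi> x) x"
      by (rule pd_cong_open[OF \<Omega> True]; simp add: g_def)+
    then show ?thesis
      using True has_pd_mult[OF d[OF True] smooth_fun_on_has_pd[OF sm]] by (simp add: G_def)
  next
    case False
    then have x: "x \<notin> ?K" using K(2) by auto
    have "has_pd i g x" "pd i g x = 0"
      by (rule pd_eq_0_outside_closed[where K = ?K]; use x g0 in simp)+
    then show ?thesis using False by (simp add: G_def)
  qed
  then have pg: "pd i g = G" by auto
  have "(\<integral>x. pd i g x \<partial>lborel) = 0"
    by (rule integral_pd_eq_0[OF cg _ _ K(1) g0]) (use cG gG pg in auto)
  then have "(\<integral>x. G x \<partial>lebesgue) = 0"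
    using cG by (simp add: pg integral_completion borel_measurable_continuous_onI)
  moreover have "(\<integral>x. u x * pd i \<phi> x + pd i u x * \<phi> x \<partial>lebesgue_on \<Omega>) = (\<integral>x. G x \<partial>lebesgue)"
    using \<Omega> by (subst integral_restrict_space)
      (auto simp: lborelD G_def indicator_def intro!: Bochner_Integration.integral_cong)
  moreover have "integrable (lebesgue_on \<Omega>) (\<lambda>x. u x * pd i \<phi> x)"
      "integrable (lebesgue_on \<Omega>) (\<lambda>x. pd i u x * \<phi> x)"
    by (intro integrable_mult_test_function \<Omega> locally_integrable_continuous u pu \<phi> test_functions_pd)+
  ultimately show ?thesis by simp
qed

text \<open>The multi-index twice the \<open>i\<close>-th unit vector admits a single order of differentiation.\<close>

lemma mderiv_double: "mderiv (\<lambda>k. if k = i then 2 else 0) f = pd i (pd i f)"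
proof -
  have "is = [i, i]" if "\<forall>k. count_list is k = (if k = i then 2 else 0)" for "is" :: "'a list"
  proof -
    have sub: "set is \<subseteq> {i}" using that by (metis count_list_0_iff singleton_iff subsetI)
    then have r: "is = replicate (length is) i"
      by (intro replicate_eqI) auto
    have "count_list (replicate n i) i = n" for n
      by (induction n) auto
    then have "length is = count_list is i"
      by (metis r)
    then show ?thesis using r that by (simp add: numeral_2_eq_2)
  qed
  then have "(SOME is. \<forall>k. count_list is k = (if k = i then 2 else 0)) = [i, i]"
    by (intro some_equality) auto
  then show ?thesis by (simp add: mderiv_def)
qed

lemma has_weak_deriv_double_pd:
  assumes \<Omega>: "open \<Omega>" and u: "Ck_on 2 \<Omega> u"
  shows "has_weak_deriv \<Omega> (\<lambda>k. if k = i then 2 else 0) u (pd i (pd i u))"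
  unfolding has_weak_deriv_def mderiv_double
proof (intro conjI ballI)
  have c: "continuous_on \<Omega> u" "continuous_on \<Omega> (pd i u)" "continuous_on \<Omega> (pd i (pd i u))"
    and d: "\<And>x. x \<in> \<Omega> \<Longrightarrow> has_pd i u x" "\<And>x. x \<in> \<Omega> \<Longrightarrow> has_pd i (pd i u) x"
    using u by (auto simp: numeral_2_eq_2)
  show "locally_integrable \<Omega> u" "locally_integrable \<Omega> (pd i (pd i u))"
    using c by (auto intro: locally_integrable_continuous)
  fix \<phi> assume \<phi>: "\<phi> \<in> test_functions \<Omega>"
  have "(\<integral>x. u x * pd i (pd i \<phi>) x \<partial>lebesgue_on \<Omega>) = (\<integral>x. pd i (pd i u) x * \<phi> x \<partial>lebesgue_on \<Omega>)"
    using integral_mult_pd_test_function[OF \<Omega> c(1,2) d(1) test_functions_pd[OF \<phi>]]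
      integral_mult_pd_test_function[OF \<Omega> c(2,3) d(2) \<phi>] by simp
  then show "(\<integral>x. u x * pd i (pd i \<phi>) x \<partial>lebesgue_on \<Omega>) =
      (- 1) ^ mi_order (\<lambda>k. if k = i then 2 else 0) * (\<integral>x. pd i (pd i u) x * \<phi> x \<partial>lebesgue_on \<Omega>)"
    by (simp add: mi_order_def)
qed

section \<open>Square-integrable functions and the norms\<close>

text \<open>Completeness of Lebesgue measure: a version of a measurable function is measurable. The
  chosen weak derivatives are only known up to null sets.\<close>

lemma borel_measurable_lebesgue_on_cong_AE:
  fixes f g :: "'a::euclidean_space \<Rightarrow> real"
  assumes S: "S \<in> sets lebesgue" and f: "f \<in> borel_measurable (lebesgue_on S)"
    and eq: "AE x in lebesgue_on S. f x = g x"
  shows "g \<in> borel_measurable (lebesgue_on S)"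
proof -
  have "AE x in lebesgue. x \<in> S \<longrightarrow> f x = g x"
    using eq S by (simp add: AE_restrict_space_iff)
  then have "AE x in lebesgue. (if x \<in> S then f x else 0) = (if x \<in> S then g x else 0)"
    by eventually_elim simp
  moreover have "(\<lambda>x. if x \<in> S then f x else 0) \<in> borel_measurable lebesgue"
    using f S by (simp add: borel_measurable_if)
  ultimately have "(\<lambda>x. if x \<in> S then g x else 0) \<in> borel_measurable lebesgue"
    by (rule borel_measurable_AE[rotated])
  then show ?thesis using S by (simp add: borel_measurable_if)
qed

lemma L2_space_diff:
  assumes "f \<in> L2_space \<Omega>" "g \<in> L2_space \<Omega>"
  shows "(\<lambda>x. f x - g x) \<in> L2_space \<Omega>"
proof -
  have [measurable]: "f \<in> borel_measurable (lebesgue_on \<Omega>)" "g \<in> borel_measurable (lebesgue_on \<Omega>)"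
    and i: "integrable (lebesgue_on \<Omega>) (\<lambda>x. (f x)\<^sup>2)" "integrable (lebesgue_on \<Omega>) (\<lambda>x. (g x)\<^sup>2)"
    using assms by (simp_all add: L2_space_def)
  have "integrable (lebesgue_on \<Omega>) (\<lambda>x. (f x - g x)\<^sup>2)"
  proof (rule Bochner_Integration.integrable_bound)
    show "integrable (lebesgue_on \<Omega>) (\<lambda>x. 2 * (f x)\<^sup>2 + 2 * (g x)\<^sup>2)"
      using i by (intro Bochner_Integration.integrable_add integrable_mult_right)
    have "(a - b)\<^sup>2 \<le> 2 * a\<^sup>2 + 2 * b\<^sup>2" for a b :: real
      using zero_le_power2[of "a + b"] by (simp add: power2_eq_square algebra_simps)
    then show "AE x in lebesgue_on \<Omega>. norm ((f x - g x)\<^sup>2) \<le> norm (2 * (f x)\<^sup>2 + 2 * (g x)\<^sup>2)"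
      by (intro AE_I2) simp
  qed measurable
  then show ?thesis by (simp add: L2_space_def)
qed

lemma L2_space_cong_AE:
  assumes \<Omega>: "open \<Omega>" and f: "f \<in> L2_space \<Omega>" and eq: "AE x in lebesgue_on \<Omega>. f x = g x"
  shows "g \<in> L2_space \<Omega>"
proof -
  have fm: "f \<in> borel_measurable (lebesgue_on \<Omega>)" and i: "integrable (lebesgue_on \<Omega>) (\<lambda>x. (f x)\<^sup>2)"
    using f by (simp_all add: L2_space_def)
  have gm: "g \<in> borel_measurable (lebesgue_on \<Omega>)"
    by (rule borel_measurable_lebesgue_on_cong_AE[OF _ fm eq]) (use \<Omega> in simp)
  have "AE x in lebesgue_on \<Omega>. (f x)\<^sup>2 = (g x)\<^sup>2"
    using eq by eventually_elim simp
  then have "integrable (lebesgue_on \<Omega>) (\<lambda>x. (g x)\<^sup>2)"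
    by (rule integrable_cong_AE_imp[OF i borel_measurable_power[OF gm], rotated])
  then show ?thesis using gm by (simp add: L2_space_def)
qed

lemma L2_norm_nonneg: "0 \<le> L2_norm \<Omega> f"
  by (simp add: L2_norm_def)

lemma L2_norm_squared: "(L2_norm \<Omega> f)\<^sup>2 = (\<integral>x. (f x)\<^sup>2 \<partial>lebesgue_on \<Omega>)"
  by (simp add: L2_norm_def)

lemma finite_multi_indices: "finite {\<beta>::'n::finite \<Rightarrow> nat. mi_order \<beta> \<le> k}"
proof (rule finite_subset)
  show "{\<beta>::'n \<Rightarrow> nat. mi_order \<beta> \<le> k} \<subseteq> PiE UNIV (\<lambda>_. {..k})"
  proof
    fix \<beta> :: "'n \<Rightarrow> nat" assume "\<beta> \<in> {\<beta>. mi_order \<beta> \<le> k}"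
    then have "\<beta> i \<le> k" for i
      using member_le_sum[of i UNIV \<beta>] by (simp add: mi_order_def)
    then show "\<beta> \<in> PiE UNIV (\<lambda>_. {..k})" by auto
  qed
  show "finite (PiE (UNIV::'n set) (\<lambda>_. {..k}))"
    by (rule finite_PiE) auto
qed

lemma mderiv_le_C2_norm:
  assumes u: "u \<in> C2_space \<Omega>" and \<beta>: "mi_order \<beta> \<le> 2" and x: "x \<in> \<Omega>"
  shows "\<bar>mderiv \<beta> u x\<bar> \<le> C2_norm \<Omega> u"
proof -
  have "bounded (mderiv \<beta> u ` \<Omega>)" using u \<beta> by (simp add: C2_space_def)
  then obtain B where "\<forall>y\<in>mderiv \<beta> u ` \<Omega>. norm y \<le> B"
    unfolding bounded_iff by (elim exE)
  then have "bdd_above ((\<lambda>x. \<bar>mderiv \<beta> u x\<bar>) ` \<Omega>)"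
    by (intro bdd_aboveI2[of _ _ B]) auto
  then have "\<bar>mderiv \<beta> u x\<bar> \<le> (SUP x\<in>\<Omega>. \<bar>mderiv \<beta> u x\<bar>)"
    using x by (intro cSUP_upper)
  also have "\<dots> \<le> C2_norm \<Omega> u"
    unfolding C2_norm_def using \<beta> by (intro Max_ge finite_imageI finite_multi_indices) auto
  finally show ?thesis .
qed

text \<open>Only the derivatives of order zero and the pure second derivatives are needed of the \<open>H\<^sup>2\<close> norm.\<close>

lemma L2_norms_le_H2_norm:
  fixes u :: "real^'n::finite \<Rightarrow> real"
  shows "(\<Sum>i\<in>UNIV. (L2_norm \<Omega> (weak_deriv \<Omega> (\<lambda>k. if k = i then 2 else 0) u))\<^sup>2) +
      (L2_norm \<Omega> (weak_deriv \<Omega> (\<lambda>_. 0) u))\<^sup>2 \<le> (H2_norm \<Omega> u)\<^sup>2"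
proof -
  define e :: "'n \<Rightarrow> 'n \<Rightarrow> nat" where "e i = (\<lambda>k. if k = i then 2 else 0)" for i
  define N where "N \<beta> = (L2_norm \<Omega> (weak_deriv \<Omega> \<beta> u))\<^sup>2" for \<beta>
  have inj: "inj e"
  proof (rule injI)
    fix i j assume "e i = e j"
    then have "e i i = e j i" by simp
    then show "i = j" by (simp add: e_def split: if_splits)
  qed
  have notin: "(\<lambda>_. 0) \<notin> range e"
  proof
    assume "(\<lambda>_. 0) \<in> range e"
    then obtain i where "(\<lambda>_. 0) = e i" by blast
    then have "0 = e i i" by metis
    then show False by (simp add: e_def)
  qed
  have "(\<Sum>i\<in>UNIV. N (e i)) + N (\<lambda>_. 0) = (\<Sum>\<beta>\<in>insert (\<lambda>_. 0) (range e). N \<beta>)"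
    using notin by (simp add: sum.reindex[OF inj] add.commute)
  also have "\<dots> \<le> (\<Sum>\<beta>\<in>{\<beta>. mi_order \<beta> \<le> 2}. N \<beta>)"
    by (rule sum_mono2[OF finite_multi_indices]) (auto simp: e_def mi_order_def N_def)
  also have "\<dots> = (H2_norm \<Omega> u)\<^sup>2"
    unfolding H2_norm_def N_def by (rule real_sqrt_pow2[symmetric]) (simp add: sum_nonneg)
  finally show ?thesis by (simp add: N_def e_def)
qed

section \<open>The stability estimate\<close>

text \<open>The pointwise estimate. Subtracting the two equations gives
  \<open>(f1 - f2) u2 = (d1 - d2)/2 - (h1 - h2) - f1 (u1 - u2)\<close>, where \<open>d1\<close> and \<open>d2\<close> denote the Laplacians;
  the first equation bounds \<open>f1\<close> by \<open>A\<close>.\<close>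

lemma potential_difference_bound:
  fixes d1 d2 :: "'n::finite \<Rightarrow> real" and c M K :: real
  defines "A \<equiv> (real CARD('n) * \<bar>M\<bar> / 2 + \<bar>K\<bar>) / c"
  assumes c: "c > 0" and eq1: "1/2 * (\<Sum>i\<in>UNIV. d1 i) - f1 * u1 = h1"
    and eq2: "1/2 * (\<Sum>i\<in>UNIV. d2 i) - f2 * u2 = h2"
    and d1: "\<And>i. \<bar>d1 i\<bar> \<le> M" and h1: "\<bar>h1\<bar> \<le> K" and u1: "u1 \<ge> c" and u2: "u2 \<ge> c"
  shows "(f1 - f2)\<^sup>2 \<le> 3 * real CARD('n) * (1 + A)\<^sup>2 / c\<^sup>2 *
      ((\<Sum>i\<in>UNIV. (d1 i - d2 i)\<^sup>2) + (u1 - u2)\<^sup>2 + (h1 - h2)\<^sup>2)"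
proof -
  define n where "n = real CARD('n)"
  have n: "n \<ge> 1" by (simp add: n_def Suc_leI)
  have A: "A \<ge> 0" using c by (simp add: A_def)
  have "\<bar>\<Sum>i\<in>UNIV. d1 i\<bar> \<le> (\<Sum>i\<in>(UNIV::'n set). \<bar>M\<bar>)"
    using d1 by (intro order_trans[OF sum_abs] sum_mono) (smt (verit))
  then have "\<bar>\<Sum>i\<in>UNIV. d1 i\<bar> \<le> n * \<bar>M\<bar>" by (simp add: n_def)
  then have "\<bar>f1 * u1\<bar> \<le> n * \<bar>M\<bar> / 2 + \<bar>K\<bar>"
    using eq1 h1 by linarith
  moreover have "\<bar>f1\<bar> * c \<le> \<bar>f1 * u1\<bar>"
    using u1 c by (simp add: abs_mult mult_left_mono)
  ultimately have f1: "\<bar>f1\<bar> \<le> A"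
    using c by (simp add: A_def n_def pos_le_divide_eq)
  define S where "S = (\<Sum>i\<in>UNIV. \<bar>d1 i - d2 i\<bar>)"
  define a where "a = \<bar>u1 - u2\<bar>"
  define b where "b = \<bar>h1 - h2\<bar>"
  have nonneg: "0 \<le> S" "0 \<le> a" "0 \<le> b" by (auto simp: S_def a_def b_def sum_nonneg)
  have dS: "\<bar>(\<Sum>i\<in>UNIV. d1 i) - (\<Sum>i\<in>UNIV. d2 i)\<bar> \<le> S"
    unfolding S_def sum_subtractf[symmetric] by (rule sum_abs)
  have abs_le: "\<bar>p\<bar> \<le> S + \<bar>h\<bar> + r" if "p = 1/2 * t - h - q" "\<bar>q\<bar> \<le> r" "\<bar>t\<bar> \<le> S" for p t h q r
    using that by linarith
  have "(f1 - f2) * u2 = 1/2 * ((\<Sum>i\<in>UNIV. d1 i) - (\<Sum>i\<in>UNIV. d2 i)) - (h1 - h2) - f1 * (u1 - u2)"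
    using eq1 eq2 by (simp add: algebra_simps)
  moreover have "\<bar>f1 * (u1 - u2)\<bar> \<le> A * a"
    using f1 by (simp add: abs_mult a_def mult_right_mono)
  ultimately have "\<bar>(f1 - f2) * u2\<bar> \<le> S + b + A * a"
    unfolding b_def by (rule abs_le) (rule dS)
  moreover have "\<bar>f1 - f2\<bar> * c \<le> \<bar>(f1 - f2) * u2\<bar>"
    using u2 c by (simp add: abs_mult mult_left_mono)
  moreover have "S + b + A * a \<le> (1 + A) * (S + a + b)"
    using A nonneg by (simp add: algebra_simps)
  ultimately have "\<bar>f1 - f2\<bar> * c \<le> (1 + A) * (S + a + b)" by linarith
  then have "(\<bar>f1 - f2\<bar> * c)\<^sup>2 \<le> ((1 + A) * (S + a + b))\<^sup>2"
    using c by (intro power_mono) auto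
  then have sq: "(f1 - f2)\<^sup>2 * c\<^sup>2 \<le> (1 + A)\<^sup>2 * (S + a + b)\<^sup>2"
    by (simp add: power_mult_distrib)
  \<comment> \<open>Two applications of the Cauchy--Schwarz inequality produce the factors 3 and \<open>n\<close>.\<close>
  have "(S + a + b)\<^sup>2 \<le> 3 * (S\<^sup>2 + a\<^sup>2 + b\<^sup>2)"
    using zero_le_power2[of "S - a"] zero_le_power2[of "S - b"] zero_le_power2[of "a - b"]
    by (simp add: power2_eq_square algebra_simps)
  also have "S\<^sup>2 \<le> (\<Sum>i\<in>UNIV. \<bar>d1 i - d2 i\<bar>\<^sup>2) * n"
    unfolding S_def n_def by (rule sum_squared_le_sum_of_squares)
  also have "3 * ((\<Sum>i\<in>UNIV. \<bar>d1 i - d2 i\<bar>\<^sup>2) * n + a\<^sup>2 + b\<^sup>2) \<le>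
      3 * ((\<Sum>i\<in>UNIV. \<bar>d1 i - d2 i\<bar>\<^sup>2) * n + n * a\<^sup>2 + n * b\<^sup>2)"
    using mult_right_mono[OF n, of "a\<^sup>2"] mult_right_mono[OF n, of "b\<^sup>2"] by simp
  finally have "(S + a + b)\<^sup>2 \<le> 3 * n * ((\<Sum>i\<in>UNIV. (d1 i - d2 i)\<^sup>2) + (u1 - u2)\<^sup>2 + (h1 - h2)\<^sup>2)"
    by (simp add: a_def b_def algebra_simps)
  then have "(f1 - f2)\<^sup>2 * c\<^sup>2 \<le> (1 + A)\<^sup>2 *
      (3 * n * ((\<Sum>i\<in>UNIV. (d1 i - d2 i)\<^sup>2) + (u1 - u2)\<^sup>2 + (h1 - h2)\<^sup>2))"
    by (intro order_trans[OF sq] mult_left_mono) auto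
  then show ?thesis
    using c by (simp add: n_def[symmetric] field_simps)
qed

lemma H2_space_has_weak_deriv:
  assumes "u \<in> H2_space \<Omega>" "mi_order \<beta> \<le> 2"
  shows "has_weak_deriv \<Omega> \<beta> u (weak_deriv \<Omega> \<beta> u)" "weak_deriv \<Omega> \<beta> u \<in> L2_space \<Omega>"
  using assms by (auto simp: H2_space_def intro: has_weak_deriv_weak_deriv)

lemma H2_space_locally_integrable: "u \<in> H2_space \<Omega> \<Longrightarrow> locally_integrable \<Omega> u"
  by (rule has_weak_derivD(1)[OF H2_space_has_weak_deriv(1)[of _ _ "\<lambda>_. 0"]])
     (simp_all add: mi_order_def)

lemma Linf_norm_le_imp_AE:
  assumes "Linf_norm \<Omega> h \<le> ereal K"
  shows "AE x in lebesgue_on \<Omega>. \<bar>h x\<bar> \<le> K"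
proof -
  have "AE x in lebesgue_on \<Omega>. ereal \<bar>h x\<bar> \<le> Linf_norm \<Omega> h"
    unfolding Linf_norm_def by (rule esssup_AE)
  then show ?thesis
    by eventually_elim (use assms order_trans in fastforce)
qed

text \<open>Integrating the pointwise estimate. The square integrability of \<open>f1 - f2\<close> is part of the
  conclusion, as neither \<open>f1\<close> nor \<open>f2\<close> is assumed to be square integrable.\<close>

lemma potential_difference_L2_estimate:
  fixes \<Omega> :: "(real^'n::finite) set" and c M K :: real
  defines "A \<equiv> (real CARD('n) * \<bar>M\<bar> / 2 + \<bar>K\<bar>) / c"
  defines "D \<equiv> 3 * real CARD('n) * (1 + A)\<^sup>2 / c\<^sup>2"
  assumes c: "c > 0" and \<Omega>: "open \<Omega>"
    and u1: "u1 \<in> H2_space \<Omega>" and u2: "u2 \<in> H2_space \<Omega>"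
    and f1: "continuous_on \<Omega> f1" and f2: "continuous_on \<Omega> f2"
    and h1: "h1 \<in> L2_space \<Omega>" and h2: "h2 \<in> L2_space \<Omega>"
    and eq1: "AE x in lebesgue_on \<Omega>. L_op \<Omega> f1 u1 x = h1 x"
    and eq2: "AE x in lebesgue_on \<Omega>. L_op \<Omega> f2 u2 x = h2 x"
    and u1C: "u1 \<in> C2_space \<Omega>" and M: "C2_norm \<Omega> u1 \<le> M" and K: "Linf_norm \<Omega> h1 \<le> ereal K"
    and u1c: "AE x in lebesgue_on \<Omega>. u1 x \<ge> c" and u2c: "AE x in lebesgue_on \<Omega>. u2 x \<ge> c"
  shows "(\<lambda>x. f1 x - f2 x) \<in> L2_space \<Omega>"
    and "(L2_norm \<Omega> (\<lambda>x. f1 x - f2 x))\<^sup>2 \<le>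
      D * ((H2_norm \<Omega> (\<lambda>x. u1 x - u2 x))\<^sup>2 + (L2_norm \<Omega> (\<lambda>x. h1 x - h2 x))\<^sup>2)"
proof -
  define \<delta> :: "'n \<Rightarrow> 'n \<Rightarrow> nat" where "\<delta> i = (\<lambda>k. if k = i then 2 else 0)" for i
  define w where "w \<beta> = weak_deriv \<Omega> \<beta> (\<lambda>x. u1 x - u2 x)" for \<beta>
  have D: "D \<ge> 0" unfolding D_def using c by simp
  have \<delta>: "mi_order (\<delta> i) \<le> 2" for i by (simp add: \<delta>_def mi_order_def)
  have w\<beta>: "AE x in lebesgue_on \<Omega>. w \<beta> x = weak_deriv \<Omega> \<beta> u1 x - weak_deriv \<Omega> \<beta> u2 x"
    if "mi_order \<beta> \<le> 2" for \<beta>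
    unfolding w_def by (rule weak_deriv_diff_AE[OF \<Omega>
        H2_space_has_weak_deriv(1)[OF u1 that] H2_space_has_weak_deriv(1)[OF u2 that]])
  have wL2: "w \<beta> \<in> L2_space \<Omega>" if "mi_order \<beta> \<le> 2" for \<beta>
  proof (rule L2_space_cong_AE[OF \<Omega>])
    show "(\<lambda>x. weak_deriv \<Omega> \<beta> u1 x - weak_deriv \<Omega> \<beta> u2 x) \<in> L2_space \<Omega>"
      by (rule L2_space_diff[OF H2_space_has_weak_deriv(2)[OF u1 that] H2_space_has_weak_deriv(2)[OF u2 that]])
    show "AE x in lebesgue_on \<Omega>. weak_deriv \<Omega> \<beta> u1 x - weak_deriv \<Omega> \<beta> u2 x = w \<beta> x"
      using w\<beta>[OF that] by eventually_elim simp
  qed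
  have w0: "AE x in lebesgue_on \<Omega>. w (\<lambda>_. 0) x = u1 x - u2 x"
    unfolding w_def
    by (intro weak_deriv_zero_AE[OF \<Omega>] locally_integrable_diff H2_space_locally_integrable u1 u2)
  have w0L2: "w (\<lambda>_. 0) \<in> L2_space \<Omega>" by (rule wL2) (simp add: mi_order_def)
  have wi: "AE x in lebesgue_on \<Omega>. \<forall>i\<in>UNIV. w (\<delta> i) x = weak_deriv \<Omega> (\<delta> i) u1 x - weak_deriv \<Omega> (\<delta> i) u2 x"
    by (rule AE_finite_allI) (use w\<beta> \<delta> in auto)
  have bound: "AE x in lebesgue_on \<Omega>. \<forall>i\<in>UNIV. \<bar>weak_deriv \<Omega> (\<delta> i) u1 x\<bar> \<le> M"
  proof (rule AE_finite_allI)
    fix i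
    have "Ck_on 2 \<Omega> u1" using u1C by (simp add: C2_space_def)
    then have "AE x in lebesgue_on \<Omega>. weak_deriv \<Omega> (\<delta> i) u1 x = pd i (pd i u1) x"
      unfolding \<delta>_def by (rule weak_deriv_eq_AE[OF \<Omega> has_weak_deriv_double_pd[OF \<Omega>]])
    moreover have "AE x in lebesgue_on \<Omega>. x \<in> \<Omega>"
      by (rule AE_I2) simp
    ultimately show "AE x in lebesgue_on \<Omega>. \<bar>weak_deriv \<Omega> (\<delta> i) u1 x\<bar> \<le> M"
    proof eventually_elim
      case (elim x)
      then show ?case
        using mderiv_le_C2_norm[OF u1C \<delta>, of x i] M by (simp add: \<delta>_def mderiv_double)
    qed
  qed simp
  define R where "R x = (\<Sum>i\<in>UNIV. (w (\<delta> i) x)\<^sup>2) + (w (\<lambda>_. 0) x)\<^sup>2 + (h1 x - h2 x)\<^sup>2" for x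
  have ptw: "AE x in lebesgue_on \<Omega>. (f1 x - f2 x)\<^sup>2 \<le> D * R x"
    using wi w0 bound eq1 eq2 Linf_norm_le_imp_AE[OF K] u1c u2c
  proof eventually_elim
    case (elim x)
    then have e: "1/2 * (\<Sum>i\<in>UNIV. weak_deriv \<Omega> (\<delta> i) u1 x) - f1 x * u1 x = h1 x"
        "1/2 * (\<Sum>i\<in>UNIV. weak_deriv \<Omega> (\<delta> i) u2 x) - f2 x * u2 x = h2 x"
      by (simp_all only: L_op_def weak_laplacian_def \<delta>_def)
    have "R x = (\<Sum>i\<in>UNIV. (weak_deriv \<Omega> (\<delta> i) u1 x - weak_deriv \<Omega> (\<delta> i) u2 x)\<^sup>2) +
        (u1 x - u2 x)\<^sup>2 + (h1 x - h2 x)\<^sup>2"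
      using elim(1,2) by (simp add: R_def)
    then show ?case
      unfolding D_def A_def
      using potential_difference_bound[OF c e, of M K] elim by simp
  qed
  have hL2: "(\<lambda>x. h1 x - h2 x) \<in> L2_space \<Omega>" by (rule L2_space_diff[OF h1 h2])
  have ints: "integrable (lebesgue_on \<Omega>) (\<lambda>x. (w (\<delta> i) x)\<^sup>2)"
      "integrable (lebesgue_on \<Omega>) (\<lambda>x. (w (\<lambda>_. 0) x)\<^sup>2)"
      "integrable (lebesgue_on \<Omega>) (\<lambda>x. (h1 x - h2 x)\<^sup>2)" for i
    using wL2[OF \<delta>[of i]] w0L2 hL2 by (simp_all add: L2_space_def)
  have Ri: "integrable (lebesgue_on \<Omega>) R"
    unfolding R_def[abs_def] by (intro Bochner_Integration.integrable_add Bochner_Integration.integrable_sum ints)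
  have R_int: "(\<integral>x. R x \<partial>lebesgue_on \<Omega>) =
      (\<Sum>i\<in>UNIV. (L2_norm \<Omega> (w (\<delta> i)))\<^sup>2) + (L2_norm \<Omega> (w (\<lambda>_. 0)))\<^sup>2 + (L2_norm \<Omega> (\<lambda>x. h1 x - h2 x))\<^sup>2"
    unfolding R_def L2_norm_squared using ints by simp
  have fm: "(\<lambda>x. f1 x - f2 x) \<in> borel_measurable (lebesgue_on \<Omega>)"
    using f1 f2 \<Omega> by (intro continuous_imp_measurable_on_sets_lebesgue continuous_intros) auto
  have fi: "integrable (lebesgue_on \<Omega>) (\<lambda>x. (f1 x - f2 x)\<^sup>2)"
  proof (rule Bochner_Integration.integrable_bound[OF integrable_mult_right[OF Ri, of D]])
    show "AE x in lebesgue_on \<Omega>. norm ((f1 x - f2 x)\<^sup>2) \<le> norm (D * R x)"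
      using ptw by eventually_elim simp
  qed (use fm in simp)
  then show "(\<lambda>x. f1 x - f2 x) \<in> L2_space \<Omega>"
    using fm by (simp add: L2_space_def)
  have "(L2_norm \<Omega> (\<lambda>x. f1 x - f2 x))\<^sup>2 \<le> (\<integral>x. D * R x \<partial>lebesgue_on \<Omega>)"
    unfolding L2_norm_squared by (rule integral_mono_AE[OF fi integrable_mult_right[OF Ri] ptw])
  also have "\<dots> = D * (\<integral>x. R x \<partial>lebesgue_on \<Omega>)" by simp
  also have "\<dots> \<le> D * ((H2_norm \<Omega> (\<lambda>x. u1 x - u2 x))\<^sup>2 + (L2_norm \<Omega> (\<lambda>x. h1 x - h2 x))\<^sup>2)"
    unfolding R_int w_def \<delta>_def
    by (intro mult_left_mono[OF _ D] add_right_mono L2_norms_le_H2_norm)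
  finally show "(L2_norm \<Omega> (\<lambda>x. f1 x - f2 x))\<^sup>2 \<le>
      D * ((H2_norm \<Omega> (\<lambda>x. u1 x - u2 x))\<^sup>2 + (L2_norm \<Omega> (\<lambda>x. h1 x - h2 x))\<^sup>2)" .
qed

theorem lemma2p10:
  fixes cmin M K :: real
  assumes "cmin > 0"
  shows "\<exists>C>0. \<forall>(\<Omega> :: (real^'n::finite) set) u1 u2 f1 f2 h1 h2.
    smooth_bounded_domain \<Omega> \<longrightarrow>
    u1 \<in> H2_space \<Omega> \<longrightarrow> u2 \<in> H2_space \<Omega> \<longrightarrow>
    continuous_on \<Omega> f1 \<longrightarrow> continuous_on \<Omega> f2 \<longrightarrow>
    h1 \<in> L2_space \<Omega> \<longrightarrow> h2 \<in> L2_space \<Omega> \<longrightarrow>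
    (AE x in lebesgue_on \<Omega>. L_op \<Omega> f1 u1 x = h1 x) \<longrightarrow>
    (AE x in lebesgue_on \<Omega>. L_op \<Omega> f2 u2 x = h2 x) \<longrightarrow>
    u1 \<in> C2_space \<Omega> \<longrightarrow> h1 \<in> Linf_space \<Omega> \<longrightarrow>
    C2_norm \<Omega> u1 \<le> M \<longrightarrow> Linf_norm \<Omega> h1 \<le> ereal K \<longrightarrow>
    (AE x in lebesgue_on \<Omega>. u1 x \<ge> cmin) \<longrightarrow> (AE x in lebesgue_on \<Omega>. u2 x \<ge> cmin) \<longrightarrow>
    (\<lambda>x. f1 x - f2 x) \<in> L2_space \<Omega> \<and>
    L2_norm \<Omega> (\<lambda>x. f1 x - f2 x) \<le>
      C * (H2_norm \<Omega> (\<lambda>x. u1 x - u2 x) + L2_norm \<Omega> (\<lambda>x. h1 x - h2 x))"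
proof -
  define A where "A = (real CARD('n) * \<bar>M\<bar> / 2 + \<bar>K\<bar>) / cmin"
  define D where "D = 3 * real CARD('n) * (1 + A)\<^sup>2 / cmin\<^sup>2"
  have "A \<ge> 0" using assms by (simp add: A_def)
  then have "(1 + A)\<^sup>2 > 0" by simp
  then have D: "D > 0" using assms by (simp add: D_def)
  show ?thesis
  proof (intro exI[of _ "sqrt D"] conjI allI impI)
    show "sqrt D > 0" using D by simp
    fix \<Omega> :: "(real^'n) set" and u1 u2 f1 f2 h1 h2
    assume hyps: "smooth_bounded_domain \<Omega>" "u1 \<in> H2_space \<Omega>" "u2 \<in> H2_space \<Omega>"
      "continuous_on \<Omega> f1" "continuous_on \<Omega> f2" "h1 \<in> L2_space \<Omega>" "h2 \<in> L2_space \<Omega>"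
      "AE x in lebesgue_on \<Omega>. L_op \<Omega> f1 u1 x = h1 x" "AE x in lebesgue_on \<Omega>. L_op \<Omega> f2 u2 x = h2 x"
      "u1 \<in> C2_space \<Omega>" "h1 \<in> Linf_space \<Omega>" "C2_norm \<Omega> u1 \<le> M" "Linf_norm \<Omega> h1 \<le> ereal K"
      "AE x in lebesgue_on \<Omega>. u1 x \<ge> cmin" "AE x in lebesgue_on \<Omega>. u2 x \<ge> cmin"
    have "open \<Omega>" using hyps(1) by (simp add: smooth_bounded_domain_def)
    note est = potential_difference_L2_estimate[OF assms this hyps(2-10,12-15), folded A_def, folded D_def]
    show "(\<lambda>x. f1 x - f2 x) \<in> L2_space \<Omega>" by (rule est(1))
    let ?a = "H2_norm \<Omega> (\<lambda>x. u1 x - u2 x)" and ?b = "L2_norm \<Omega> (\<lambda>x. h1 x - h2 x)"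
    have ab: "?a \<ge> 0" "?b \<ge> 0" by (simp_all add: H2_norm_def sum_nonneg L2_norm_nonneg)
    have "(L2_norm \<Omega> (\<lambda>x. f1 x - f2 x))\<^sup>2 \<le> D * (?a\<^sup>2 + ?b\<^sup>2)" by (rule est(2))
    also have "\<dots> \<le> D * (?a + ?b)\<^sup>2"
      using D ab by (intro mult_left_mono) (auto simp: power2_sum)
    also have "\<dots> = (sqrt D * (?a + ?b))\<^sup>2"
      using D by (simp add: power_mult_distrib)
    finally show "L2_norm \<Omega> (\<lambda>x. f1 x - f2 x) \<le> sqrt D * (?a + ?b)"
      by (rule power2_le_imp_le) (use D ab in simp)
  qed
qed

end
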